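(* Let $n\geq 3$ be an integer. If $\lceil\sqrt{n}\,\rceil=p$ is a prime number, then $O\chi_{p-2}(C_n)=p$.
   Context: $C_n$ denotes the cycle graph on $n$ vertices. All colourings are proper vertex colourings. Two colourings of a graph are orthogonal if whenever two distinct vertices receive the same colour in one colouring, they receive distinct colours in the other. A $k$-orthogonal colouring is a collection of $k$ mutually (pairwise) orthogonal proper colourings. $O\chi_k(G)$, the $k$-orthogonal chromatic number, is the minimum number of colours needed for a $k$-orthogonal colouring of $G$ (all colourings drawing from the same set of that many colours).
   Formalization: The values n = 3, 4, 6, 8 are excluded, since the claim fails there: for n = 3, 4 we have p − 2 = 0 and an empty collection needs no colours; for n = 6, 8 we have p = 3 and the even cycle needs only 2 colours in a single colouring. *)

theory Defs
  imports
    Complex_Main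
    "HOL-Computational_Algebra.Primes"
    "Graph_Theory.Pair_Digraph"
begin

text \<open>A finite simple graph is represented, as in the library, by a \<^locale>\<open>pair_graph\<close>:
  every undirected edge \<open>uv\<close> occurs as the two arcs \<open>(u, v)\<close> and \<open>(v, u)\<close>.\<close>

definition cycle_graph :: "nat \<Rightarrow> nat pair_pre_digraph" where
  "cycle_graph n =
     \<lparr> pverts = {..<n},
       parcs = {(i, j). i < n \<and> j < n \<and> (j = (i + 1) mod n \<or> i = (j + 1) mod n)} \<rparr>"

lemma pair_graph_cycle_graph:
  assumes "n \<ge> 3"
  shows "pair_graph (cycle_graph n)"
proof
  have "parcs (cycle_graph n) \<subseteq> {..<n} \<times> {..<n}"
    by (auto simp: cycle_graph_def)
  then show "finite (parcs (cycle_graph n))"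
    by (rule finite_subset) simp
  show "fst e \<noteq> snd e" if "e \<in> parcs (cycle_graph n)" for e
    using that assms by (auto simp: cycle_graph_def mod_Suc split: if_splits)
qed (auto simp: cycle_graph_def symmetric_def sym_def)

definition proper_colouring :: "'a pair_pre_digraph \<Rightarrow> nat \<Rightarrow> ('a \<Rightarrow> nat) \<Rightarrow> bool" where
  "proper_colouring G m c \<longleftrightarrow>
     (\<forall>v\<in>pverts G. c v < m) \<and> (\<forall>(u, v)\<in>parcs G. c u \<noteq> c v)"

text \<open>The condition is symmetric in \<open>c\<close> and \<open>d\<close>.\<close>

definition orthogonal_colourings ::
  "'a pair_pre_digraph \<Rightarrow> ('a \<Rightarrow> nat) \<Rightarrow> ('a \<Rightarrow> nat) \<Rightarrow> bool" where
  "orthogonal_colourings G c d \<longleftrightarrow>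
     (\<forall>u\<in>pverts G. \<forall>v\<in>pverts G. u \<noteq> v \<longrightarrow> c u = c v \<longrightarrow> d u \<noteq> d v)"

definition k_orthogonal_colouring ::
  "nat \<Rightarrow> 'a pair_pre_digraph \<Rightarrow> nat \<Rightarrow> (nat \<Rightarrow> 'a \<Rightarrow> nat) \<Rightarrow> bool" where
  "k_orthogonal_colouring k G m c \<longleftrightarrow>
     (\<forall>i<k. proper_colouring G m (c i)) \<and>
     (\<forall>i<k. \<forall>j<k. i \<noteq> j \<longrightarrow> orthogonal_colourings G (c i) (c j))"

definition orthogonal_chromatic_number :: "nat \<Rightarrow> 'a pair_pre_digraph \<Rightarrow> nat" where
  "orthogonal_chromatic_number k G = (LEAST m. \<exists>c. k_orthogonal_colouring k G m c)"

text \<open>The minimum is attained on every finite simple graph, so \<open>LEAST\<close> never picks a junk value.\<close>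

lemma k_orthogonal_colouring_orthogonal_chromatic_number:
  assumes "pair_graph G"
  shows "\<exists>c. k_orthogonal_colouring k G (orthogonal_chromatic_number k G) c"
proof -
  interpret pair_graph G by (fact assms)
  obtain f :: "'a \<Rightarrow> nat" where "bij_betw f (pverts G) {0..<card (pverts G)}"
    using ex_bij_betw_finite_nat[OF pair_finite_verts] by blast
  then have f: "f ` pverts G = {..<card (pverts G)}" "inj_on f (pverts G)"
    by (simp_all add: bij_betw_def lessThan_atLeast0)
  have "\<And>u v. (u, v) \<in> parcs G \<Longrightarrow> u \<in> pverts G \<and> v \<in> pverts G \<and> u \<noteq> v"
    using arc_fst_in_verts arc_snd_in_verts pair_no_loops by fastforce
  then have "k_orthogonal_colouring k G (card (pverts G)) (\<lambda>_. f)"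
    using f unfolding k_orthogonal_colouring_def proper_colouring_def orthogonal_colourings_def
    by (fastforce simp: inj_on_def)
  then show ?thesis
    unfolding orthogonal_chromatic_number_def
    by (rule_tac LeastI[where P = "\<lambda>m. \<exists>c. k_orthogonal_colouring k G m c"]) blast
qed

text \<open>For \<open>k < 2\<close> orthogonality is vacuous. If \<open>\<lceil>sqrt n\<rceil> = p\<close> is prime, the
  number for \<open>k = p - 2\<close> on the cycle with \<open>n \<ge> 3\<close> vertices therefore differs from \<open>p\<close>
  when \<open>p = 2\<close> (that is \<open>n = 3\<close> or \<open>n = 4\<close>), and when \<open>p = 3\<close> and \<open>n\<close> is even
  (that is \<open>n = 6\<close> or \<open>n = 8\<close>), as the next two lemmas show.\<close>

lemma orthogonal_chromatic_number_0: "orthogonal_chromatic_number 0 G = 0"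
  by (simp add: orthogonal_chromatic_number_def k_orthogonal_colouring_def)

lemma orthogonal_chromatic_number_1_even_cycle:
  assumes "even n" "n > 0"
  shows "orthogonal_chromatic_number 1 (cycle_graph n) = 2"
  unfolding orthogonal_chromatic_number_def
proof (rule Least_equality)
  have "even ((i + 1) mod n) \<longleftrightarrow> odd i" for i
    using assms by (metis dvd_mod_iff even_plus_one_iff)
  then have "i mod 2 \<noteq> j mod 2" if "(i, j) \<in> parcs (cycle_graph n)" for i j
    using that by (auto simp: cycle_graph_def mod2_eq_if)
  then have "k_orthogonal_colouring 1 (cycle_graph n) 2 (\<lambda>_ v. v mod 2)"
    by (auto simp: k_orthogonal_colouring_def proper_colouring_def)
  then show "\<exists>c. k_orthogonal_colouring 1 (cycle_graph n) 2 c" by blast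
next
  fix m assume "\<exists>c. k_orthogonal_colouring 1 (cycle_graph n) m c"
  then obtain c where c: "proper_colouring (cycle_graph n) m c"
    by (auto simp: k_orthogonal_colouring_def)
  have "n \<ge> 2" using assms by presburger
  then have "c 0 < m" "c 1 < m" "c 0 \<noteq> c 1"
    using c by (auto simp: proper_colouring_def cycle_graph_def)
  then show "2 \<le> m" by linarith
qed

end

theory Submission
  imports Defs "HOL-Number_Theory.Cong"
begin

text \<open>Place the vertices of the cycle injectively into \<open>{..<p\<^sup>2}\<close> by a map \<open>e\<close>, and give \<open>x = e v\<close>
  in the \<open>b\<close>-th colouring the colour \<open>x + b (x div p)\<close> modulo \<open>p\<close>. These functions are lines of distinct
  slopes on the \<open>p \<times> p\<close> grid, hence pairwise orthogonal. They separate any two points of the same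
  block \<open>{t p ..< (t + 1) p}\<close>, as well as the last point of a block and the first point of the
  next one (cyclically), where the colour changes by \<open>b + 1\<close>. So it suffices that the cycle runs through
  a subset of \<open>{..<p\<^sup>2}\<close> in increasing order, skipping only interior points of blocks, which is
  possible whenever \<open>2 p \<le> n \<le> p\<^sup>2\<close>. Conversely, two orthogonal colourings with \<open>m\<close> colours
  embed the vertices into an \<open>m \<times> m\<close> grid.

  For \<open>p = 3\<close> there is a single colouring of an odd cycle.\<close>

section \<open>Lines of the \<open>p\<close> by \<open>p\<close> grid as colour classes\<close>

definition grid_colour :: "nat \<Rightarrow> nat \<Rightarrow> nat \<Rightarrow> nat" where
  "grid_colour p b x = (x + b * (x div p)) mod p"

lemma grid_colour_same_block:
  assumes "x div p = y div p" "x \<noteq> y"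
  shows "grid_colour p b x \<noteq> grid_colour p b y"
proof
  assume "grid_colour p b x = grid_colour p b y"
  then have "[x + b * (x div p) = y + b * (x div p)] (mod p)"
    using assms(1) by (simp add: grid_colour_def cong_def)
  then have "x mod p = y mod p"
    by (simp add: cong_add_rcancel_nat) (simp add: cong_def)
  with assms show False
    by (metis div_mult_mod_eq)
qed

lemma grid_colour_next_block:
  assumes "Suc b < p" "p dvd Suc x"
  shows "grid_colour p b x \<noteq> grid_colour p b (Suc x)"
proof
  have "Suc x div p = Suc (x div p)"
    using assms by (simp add: div_Suc dvd_eq_mod_eq_0)
  moreover assume "grid_colour p b x = grid_colour p b (Suc x)"
  ultimately have "[x + b * (x div p) + 0 = x + b * (x div p) + Suc b] (mod p)"
    by (simp add: grid_colour_def cong_def add_ac)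
  then have "[0 = Suc b] (mod p)"
    by (simp only: cong_add_lcancel_nat)
  with assms(1) show False
    by (simp add: cong_def)
qed

lemma grid_colour_last_first:
  assumes "Suc b < p"
  shows "grid_colour p b (p\<^sup>2 - 1) \<noteq> grid_colour p b 0"
proof
  obtain q where q: "p = Suc q"
    using assms by (cases p) auto
  have x: "p\<^sup>2 - 1 = q * p + q"
    by (simp add: q power2_eq_square)
  have "(p\<^sup>2 - 1) div p = q"
    unfolding x by (simp add: q del: mult_Suc_right)
  moreover assume "grid_colour p b (p\<^sup>2 - 1) = grid_colour p b 0"
  ultimately have "p dvd p\<^sup>2 - 1 + b * q"
    by (simp add: grid_colour_def dvd_eq_mod_eq_0)
  then have "p dvd q * p + q + b * q"
    by (simp only: x)
  \<comment> \<open>With \<open>q = p - 1\<close> the last point has colour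
    \<open>q + b * q\<close>, which is \<open>-(b + 1)\<close> modulo \<open>p\<close>; adding
    \<open>Suc b\<close> completes it to a multiple of \<open>p\<close>.\<close>
  have "q * p + q + b * q + Suc b = p * (q + Suc b)"
    by (simp add: q algebra_simps)
  with \<open>p dvd q * p + q + b * q\<close>
  have "p dvd Suc b"
    by (metis dvd_add_right_iff dvd_triv_left)
  with assms show False
    by (auto dest: dvd_imp_le)
qed

text \<open>Subtracting the two congruences leaves \<open>p\<close> dividing
  \<open>(a - b) * (x div p - y div p)\<close>. Both factors are nonzero and smaller than
  \<open>p\<close> in absolute value, against primality. The computation runs in the integers
  because either difference may be negative.\<close>

lemma grid_colour_orthogonal:
  assumes "prime p" "a < p" "b < p" "a \<noteq> b" "x < p\<^sup>2" "y < p\<^sup>2"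
    and a: "grid_colour p a x = grid_colour p a y"
    and b: "grid_colour p b x = grid_colour p b y"
  shows "x = y"
proof (rule ccontr)
  assume "x \<noteq> y"
  then have ne: "x div p \<noteq> y div p"
    using a grid_colour_same_block by blast
  have small: "\<not> int p dvd int i - int j" if "i < p" "j < p" "i \<noteq> j" for i j
    using that by (simp flip: mod_eq_dvd_iff)
  have dvd: "int p dvd (int x + int c * int (x div p)) - (int y + int c * int (y div p))"
    if "grid_colour p c x = grid_colour p c y" for c
    using that unfolding grid_colour_def mod_eq_dvd_iff[symmetric]
    by (metis of_nat_add of_nat_mod of_nat_mult)
  have "int p dvd (int a - int b) * (int (x div p) - int (y div p))"
    using dvd_diff[OF dvd[OF a] dvd[OF b]] by (simp add: algebra_simps)
  then have "int p dvd int a - int b \<or> int p dvd int (x div p) - int (y div p)"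
    using \<open>prime p\<close> by (simp add: prime_dvd_mult_iff)
  moreover have "x div p < p" "y div p < p"
    using assms(5,6) by (simp_all add: power2_eq_square less_mult_imp_div_less)
  ultimately show False
    using small ne assms(2-4) by metis
qed

section \<open>Threading the cycle through the grid in increasing order\<close>

lemma sorted_list_of_set_nth_consecutive:
  fixes S :: "'a::linorder set"
  assumes "finite S" "Suc i < card S" "s \<in> S"
  shows "s \<le> sorted_list_of_set S ! i \<or> sorted_list_of_set S ! Suc i \<le> s"
proof -
  let ?l = "sorted_list_of_set S"
  obtain j where j: "j < card S" "s = ?l ! j"
    using assms by (metis in_set_conv_nth length_sorted_list_of_set set_sorted_list_of_set)
  have "j \<le> i \<or> Suc i \<le> j" by linarith
  then show ?thesis
    using j assms sorted_nth_mono[of ?l] by auto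
qed

lemma proper_colouring_cycle_graph_iff:
  "proper_colouring (cycle_graph n) m c \<longleftrightarrow>
     (\<forall>i<n. c i < m) \<and> (\<forall>i<n. c i \<noteq> c (Suc i mod n))"
  by (fastforce simp: proper_colouring_def cycle_graph_def)

lemma ex_increasing_embedding:
  assumes "p > 1" "2 * p \<le> n" "n \<le> p\<^sup>2"
  obtains e :: "nat \<Rightarrow> nat" where
    "inj_on e {..<n}" "e ` {..<n} \<subseteq> {..<p\<^sup>2}" "e 0 = 0" "e (n - 1) = p\<^sup>2 - 1"
    "\<And>i. Suc i < n \<Longrightarrow>
       e i div p = e (Suc i) div p \<or> p dvd Suc (e i) \<and> e (Suc i) = Suc (e i)"
proof -
  \<comment> \<open>The first and last points of all blocks, at most \<open>2 * p\<close> in number: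
    they must be visited, and any further points may fill up to \<open>n\<close>.\<close>
  define B where "B = (\<lambda>t. t * p) ` {..<p} \<union> (\<lambda>t. t * p + (p - 1)) ` {..<p}"
  have block: "t * p + s < p\<^sup>2" if "t < p" "s < p" for s t
  proof -
    have "t * p + s < Suc t * p" using that by simp
    also have "\<dots> \<le> p * p" using that by (intro mult_right_mono) auto
    finally show ?thesis by (simp add: power2_eq_square)
  qed
  have B: "B \<subseteq> {..<p\<^sup>2}"
    using block[of _ 0] block[of _ "p - 1"] assms(1) by (auto simp: B_def)
  have "card B \<le> card {..<p} + card {..<p}"
    unfolding B_def by (intro card_Un_le[THEN order_trans] add_mono card_image_le) auto
  then have "card B \<le> n" using assms by simp
  then obtain S where S: "B \<subseteq> S" "S \<subseteq> {..<p\<^sup>2}" "card S = n"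
    using exists_subset_between[of B n "{..<p\<^sup>2}"] B assms(3) by auto
  have fin: "finite S" using S(2) finite_subset by blast
  define e where "e = (!) (sorted_list_of_set S)"
  have mono: "e i < e j" if "i < j" "j < n" for i j
    unfolding e_def using that S(3) strict_sorted_list_of_set[of S]
    by (metis length_sorted_list_of_set sorted_wrt_nth_less)
  have mem: "e i \<in> S" if "i < n" for i
    using that S(3) fin by (metis e_def length_sorted_list_of_set nth_mem set_sorted_list_of_set)
  have index: "\<exists>i<n. e i = s" if "s \<in> S" for s
    using that S(3) fin by (metis e_def in_set_conv_nth length_sorted_list_of_set set_sorted_list_of_set)
  have inj: "inj_on e {..<n}"
    using mono by (intro linorder_inj_onI') fastforce
  have "0 \<in> B" using assms(1) by (auto simp: B_def)
  then obtain i where "i < n" "e i = 0" using S(1) index by blast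
  then have first: "e 0 = 0" using mono[of 0 i] by (cases "i = 0") auto
  have "(p - 1) * p + (p - 1) = p\<^sup>2 - 1"
    using assms(1) by (cases p) (auto simp: power2_eq_square)
  then have "p\<^sup>2 - 1 \<in> B" using assms(1)
    by (auto simp: B_def intro!: image_eqI[where x = "p - 1"])
  then obtain j where j: "j < n" "e j = p\<^sup>2 - 1" using S(1) index by blast
  have "e (n - 1) < p\<^sup>2" using mem[of "n - 1"] j(1) S(2) by auto
  \<comment> \<open>No value exceeds \<open>p\<^sup>2 - 1\<close>, so nothing can follow it in the
    increasing enumeration.\<close>
  then have "\<not> j < n - 1"
    using j mono[of j "n - 1"] by auto
  then have last: "e (n - 1) = p\<^sup>2 - 1"
    using j by (metis One_nat_def Suc_pred less_Suc_eq not_less_zero zero_less_iff_neq_zero)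
  have step: "e i div p = e (Suc i) div p \<or> p dvd Suc (e i) \<and> e (Suc i) = Suc (e i)"
    if i: "Suc i < n" for i
  proof (unfold disj_imp, rule impI)
    let ?t = "e i div p"
    assume ne: "\<not> e i div p = e (Suc i) div p"
    have lt: "e i < e (Suc i)" using mono i by simp
    with ne have "Suc ?t \<le> e (Suc i) div p"
      using div_le_mono[of "e i" "e (Suc i)" p] by simp
    then have ge: "Suc ?t * p \<le> e (Suc i)"
      using assms(1) by (simp only: less_eq_div_iff_mult_less_eq)
    have gt: "e i < Suc ?t * p"
      using assms(1) by (simp add: dividend_less_div_times add.commute)
    \<comment> \<open>The block after that of \<open>e i\<close> still lies in the square, so its
      first point belongs to \<open>B\<close>.\<close>
    have "e (Suc i) < p * p" using mem[OF i] S(2) by (auto simp: power2_eq_square)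
    with ge have T: "Suc ?t < p"
      by (meson le_less_trans mult_less_cancel2)
    have gap: "s \<le> e i \<or> e (Suc i) \<le> s" if "s \<in> S" for s
      unfolding e_def using sorted_list_of_set_nth_consecutive[OF fin _ that] i S(3) by simp
    \<comment> \<open>The two neighbouring boundary points are in \<open>S\<close> and cannot be
      jumped over, which pins \<open>e i\<close> to the first of them and \<open>e (Suc i)\<close>
      to the second.\<close>
    have "?t * p + (p - 1) \<in> S" "Suc ?t * p \<in> S"
      using S(1) T by (auto simp: B_def simp del: mult_Suc)
    then have "?t * p + (p - 1) \<le> e i" "e (Suc i) \<le> Suc ?t * p"
      using gap[of "?t * p + (p - 1)"] gap[of "Suc ?t * p"] ge gt assms(1) by auto
    then have "Suc (e i) = Suc ?t * p" "e (Suc i) = Suc ?t * p"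
      using ge gt by auto
    then show "p dvd Suc (e i) \<and> e (Suc i) = Suc (e i)"
      by (metis dvd_triv_right)
  qed
  show thesis
  proof (rule that)
    show "e ` {..<n} \<subseteq> {..<p\<^sup>2}" using mem S(2) by blast
  qed (fact inj first last step)+
qed

section \<open>Orthogonal colourings of long cycles with \<open>p\<close> colours\<close>

lemma k_orthogonal_colouring_cycle_graph:
  assumes "prime p" "k < p" "2 * p \<le> n" "n \<le> p\<^sup>2"
  shows "\<exists>c. k_orthogonal_colouring k (cycle_graph n) p c"
proof -
  have "p > 1" using assms(1) by (rule prime_gt_1_nat)
  then obtain e :: "nat \<Rightarrow> nat" where e:
    "inj_on e {..<n}" "e ` {..<n} \<subseteq> {..<p\<^sup>2}" "e 0 = 0" "e (n - 1) = p\<^sup>2 - 1"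
    "\<And>i. Suc i < n \<Longrightarrow>
       e i div p = e (Suc i) div p \<or> p dvd Suc (e i) \<and> e (Suc i) = Suc (e i)"
    using ex_increasing_embedding[OF _ assms(3,4)] by metis
  have "proper_colouring (cycle_graph n) p (grid_colour p b \<circ> e)" if "b < k" for b
    unfolding proper_colouring_cycle_graph_iff
  proof (intro conjI allI impI)
    fix i assume i: "i < n"
    show "(grid_colour p b \<circ> e) i < p"
      using \<open>p > 1\<close> by (simp add: grid_colour_def)
    \<comment> \<open>Slope \<open>p - 1\<close> would repeat a colour across each block boundary;
      \<open>b < k\<close> and \<open>k < p\<close> exclude it.\<close>
    have b: "Suc b < p" using that assms(2) by simp
    show "(grid_colour p b \<circ> e) i \<noteq> (grid_colour p b \<circ> e) (Suc i mod n)"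
    proof (cases "Suc i = n")
      case True
      then have "i = n - 1" by simp
      with True show ?thesis
        using grid_colour_last_first[OF b] e(3,4) by simp
    next
      case False
      then have i': "Suc i < n" using i by simp
      then have "e i \<noteq> e (Suc i)"
        using inj_on_eq_iff[OF e(1), of i "Suc i"] by simp
      then show ?thesis
        using e(5)[OF i'] grid_colour_same_block grid_colour_next_block[OF b] i' by auto
    qed
  qed
  moreover have "orthogonal_colourings (cycle_graph n) (grid_colour p a \<circ> e) (grid_colour p b \<circ> e)"
    if "a < k" "b < k" "a \<noteq> b" for a b
    unfolding orthogonal_colourings_def
  proof (intro ballI impI notI)
    fix u v
    assume uv: "u \<in> pverts (cycle_graph n)" "v \<in> pverts (cycle_graph n)" "u \<noteq> v"
      and eq: "(grid_colour p a \<circ> e) u = (grid_colour p a \<circ> e) v"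
        "(grid_colour p b \<circ> e) u = (grid_colour p b \<circ> e) v"
    have lt: "u < n" "v < n" using uv by (auto simp: cycle_graph_def)
    then have "e u < p\<^sup>2" "e v < p\<^sup>2" using e(2) by auto
    then have "e u = e v"
      using grid_colour_orthogonal[of p a b "e u" "e v"] eq that assms(1,2) by simp
    with uv lt e(1) show False by (auto simp: inj_on_def)
  qed
  ultimately have "k_orthogonal_colouring k (cycle_graph n) p (\<lambda>b. grid_colour p b \<circ> e)"
    by (simp add: k_orthogonal_colouring_def)
  then show ?thesis by blast
qed

section \<open>Lower bound by counting pairs of colours\<close>

lemma card_pverts_le_k_orthogonal_colouring:
  assumes "k_orthogonal_colouring k G m c" "k \<ge> 2"
  shows "card (pverts G) \<le> m\<^sup>2"
proof -
  have "proper_colouring G m (c 0)" "proper_colouring G m (c 1)"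
    "orthogonal_colourings G (c 0) (c 1)"
    using assms by (simp_all add: k_orthogonal_colouring_def)
  then have "inj_on (\<lambda>v. (c 0 v, c 1 v)) (pverts G)"
    "(\<lambda>v. (c 0 v, c 1 v)) ` pverts G \<subseteq> {..<m} \<times> {..<m}"
    by (auto simp: inj_on_def orthogonal_colourings_def proper_colouring_def)
  then have "card (pverts G) \<le> card ({..<m} \<times> {..<m})"
    by (intro card_inj_on_le) auto
  then show ?thesis by (simp add: power2_eq_square)
qed

section \<open>A single colouring of an odd cycle\<close>

lemma proper_colouring_odd_cycle_ge_3:
  assumes "odd n" "proper_colouring (cycle_graph n) m c"
  shows "m \<ge> 3"
proof (rule ccontr)
  assume "\<not> m \<ge> 3"
  then have c: "c i < 2" "c i \<noteq> c (Suc i mod n)" if "i < n" for i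
    using assms(2) that by (auto simp: proper_colouring_cycle_graph_iff)
  \<comment> \<open>Two colours must alternate along the path, so the even positions
    \<open>0\<close> and \<open>n - 1\<close>, which the closing edge joins, get the same
    colour.\<close>
  have parity: "even (c i) \<longleftrightarrow> (even i \<longleftrightarrow> even (c 0))" if "i < n" for i
    using that
  proof (induction i)
    case (Suc i)
    then have "c i < 2" "c (Suc i) < 2" "c i \<noteq> c (Suc i)"
      using c(1)[of i] c(1)[of "Suc i"] c(2)[of i] by auto
    then have "even (c (Suc i)) \<longleftrightarrow> odd (c i)" by (auto simp: less_2_cases_iff)
    with Suc show ?case by auto
  qed simp
  have last: "n - 1 < n" "even (n - 1)" "Suc (n - 1) mod n = 0"
    using assms(1) by (auto simp: odd_pos)
  have "even (c (n - 1)) \<longleftrightarrow> even (c 0)"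
    using parity[OF last(1)] last(2) by simp
  moreover have "c (n - 1) < 2" "c 0 < 2"
    using c(1) last(1) by simp_all
  moreover have "c (n - 1) \<noteq> c 0"
    using c(2)[OF last(1)] last(3) by simp
  ultimately show False by (auto simp: less_2_cases_iff)
qed

lemma orthogonal_chromatic_number_1_odd_cycle:
  assumes "odd n" "n \<ge> 3"
  shows "orthogonal_chromatic_number 1 (cycle_graph n) = 3"
  unfolding orthogonal_chromatic_number_def
proof (rule Least_equality)
  \<comment> \<open>Parity fails only on the edge from \<open>n - 1\<close> to \<open>0\<close>,
    both even, so the last vertex takes the third colour.\<close>
  let ?c = "\<lambda>v. if v = n - 1 then 2 else v mod 2"
  have "proper_colouring (cycle_graph n) 3 ?c"
    unfolding proper_colouring_cycle_graph_iff
    using assms by (auto simp: mod_Suc less_Suc_eq split: if_splits)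
  then show "\<exists>c. k_orthogonal_colouring 1 (cycle_graph n) 3 c"
    by (intro exI[of _ "\<lambda>_. ?c"]) (simp add: k_orthogonal_colouring_def)
next
  fix m assume "\<exists>c. k_orthogonal_colouring 1 (cycle_graph n) m c"
  then show "3 \<le> m"
    using proper_colouring_odd_cycle_ge_3[OF assms(1)] by (auto simp: k_orthogonal_colouring_def)
qed

theorem theorem4:
  fixes n p :: nat
  assumes "n \<ge> 3"
    and "\<lceil>sqrt (real n)\<rceil> = int p"
    and "prime p"
    and "n \<notin> {3, 4, 6, 8}"
  shows "orthogonal_chromatic_number (p - 2) (cycle_graph n) = p"
proof -
  \<comment> \<open>The ceiling makes \<open>p\<close> the least number whose square is at least
    \<open>n\<close>. This yields both bounds on \<open>n\<close> and the minimality of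
    \<open>p\<close>.\<close>
  have le_iff: "p \<le> m \<longleftrightarrow> n \<le> m\<^sup>2" for m
  proof -
    have "p \<le> m \<longleftrightarrow> sqrt (real n) \<le> real m"
      using ceiling_le_iff[of "sqrt (real n)" "int m"] assms(2) by simp
    also have "\<dots> \<longleftrightarrow> n \<le> m\<^sup>2"
      by (metis of_nat_0_le_iff of_nat_le_iff of_nat_power real_sqrt_le_iff real_sqrt_unique)
    finally show ?thesis .
  qed
  have up: "n \<le> p\<^sup>2" using le_iff[of p] by simp
  have low: "(p - 1)\<^sup>2 < n"
    using le_iff[of "p - 1"] prime_gt_1_nat[OF assms(3)] by linarith
  consider "p = 2" | "p = 3" | "p \<ge> 4"
    using prime_gt_1_nat[OF assms(3)] by linarith
  then show ?thesis
  proof cases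
    case 1
    then show ?thesis using up assms(1,4) by auto
  next
    case 2
    \<comment> \<open>Here \<open>4 < n \<le> 9\<close>, and the excluded values are the even
      ones.\<close>
    then have "n \<in> {5, 7, 9}" using up low assms(4) by auto
    then have "odd n" by auto
    then show ?thesis
      using 2 orthogonal_chromatic_number_1_odd_cycle assms(1) by simp
  next
    case 3
    \<comment> \<open>\<open>n > (p - 1)\<^sup>2 \<ge> 3 * (p - 1) \<ge> 2 * p\<close> gives the
      room that the embedding needs.\<close>
    then have "(3::nat) * (p - 1) \<le> (p - 1) * (p - 1)"
      by (intro mult_right_mono) auto
    then have "2 * p \<le> n"
      using 3 low unfolding power2_eq_square by linarith
    then have "\<exists>c. k_orthogonal_colouring (p - 2) (cycle_graph n) p c"
      using 3 up assms(3) by (intro k_orthogonal_colouring_cycle_graph) auto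
    \<comment> \<open>Since \<open>p - 2 \<ge> 2\<close>, there are two colourings to pair, hence
      \<open>n \<le> m\<^sup>2\<close>.\<close>
    moreover have "p \<le> m" if "k_orthogonal_colouring (p - 2) (cycle_graph n) m c" for m c
      using card_pverts_le_k_orthogonal_colouring[OF that] 3 le_iff by (simp add: cycle_graph_def)
    ultimately show ?thesis
      unfolding orthogonal_chromatic_number_def by (intro Least_equality) blast+
  qed
qed

end
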